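(* Let $T$ be a simple tree with vertex set $\{v_1,v_2,\ldots,v_n\}$, $n\ge 2$, and let $k$ be a nonnegative integer. For $\sigma\in\mathcal S_n$, let $\phi_{\sigma,k}(T)=0$ if $\sigma$ has at least one fixed point, and otherwise let $\phi_{\sigma,k}(T)$ be the number of integer solutions $(x_1,\dots,x_n)$ of $x_1+x_2+\cdots+x_n=k$ satisfying $0\le x_i<d(v_i,v_{\sigma(i)})$ for $1\le i\le n$. Let $M_{n,k}(T)=\sum_{\sigma\in\mathcal S_n}\mathrm{sgn}(\sigma)\,\phi_{\sigma,k}(T)$. Then $$M_{n,k}(T)=(-1)^{n-1}(n-1)\binom{n-2}{k}.$$ In particular, $M_{n,k}(T)$ is independent of the structure of $T$.
   Context: $\mathcal S_n$ is the set of permutations of $\{1,\dots,n\}$ and $\mathrm{sgn}(\sigma)$ is the sign of $\sigma$ ($+1$ for even, $-1$ for odd permutations). A simple tree is a finite tree in which every edge has weight $1$, so that $d(u,v)$ is the number of edges on the unique path between vertices $u$ and $v$ (with $d(u,u)=0$). Binomial coefficients $\binom{m}{j}$ with $j>m\ge 0$ are $0$. *)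

theory Defs
  imports "Graph_Theory.Graph_Theory" "HOL-Combinatorics.Permutations" "HOL-Library.FuncSet"
begin

text \<open>
  A finite simple graph is a \<^locale>\<open>pair_graph\<close>: every edge is represented by its two arcs.
  Digraph_Component.tree is not usable here: \<^const>\<open>pre_digraph.cycle\<close> is a directed notion
  which counts going back and forth along one edge as a cycle (so that no symmetric graph with an
  edge is a \<^const>\<open>forest\<close>). In a graph without loops and parallel arcs the undirected cycles are
  the directed cycles of length at least 3.
\<close>

definition simple_tree :: "'a pair_pre_digraph \<Rightarrow> bool" where
  "simple_tree T \<longleftrightarrow>
     pair_graph T \<and>
     Digraph_Component.connected (with_proj T) \<and>
     \<not> (\<exists>c. pre_digraph.cycle (with_proj T) c \<and> 3 \<le> length c)"

text \<open>Paths are lists of arcs, hence the length of a path is its number of edges.\<close>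

definition tree_dist :: "'a pair_pre_digraph \<Rightarrow> 'a \<Rightarrow> 'a \<Rightarrow> nat" where
  "tree_dist T u w = length (THE p. pre_digraph.apath (with_proj T) u p w)"

text \<open>
  The vertices are enumerated as \<open>v 1, \<dots>, v n\<close>. Tuples \<open>(x\<^sub>1, \<dots>, x\<^sub>n)\<close> are functions that are
  \<^const>\<open>undefined\<close> outside \<open>{1..n}\<close>, so that distinct functions are distinct tuples.
\<close>

definition phi :: "nat \<Rightarrow> (nat \<Rightarrow> 'a) \<Rightarrow> 'a pair_pre_digraph \<Rightarrow> (nat \<Rightarrow> nat) \<Rightarrow> nat \<Rightarrow> nat" where
  "phi n v T \<sigma> k =
     (if \<exists>i\<in>{1..n}. \<sigma> i = i then 0
      else card {x \<in> {1..n} \<rightarrow>\<^sub>E (UNIV :: int set).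
             (\<Sum>i\<in>{1..n}. x i) = int k \<and>
             (\<forall>i\<in>{1..n}. 0 \<le> x i \<and> x i < int (tree_dist T (v i) (v (\<sigma> i))))})"

definition M :: "nat \<Rightarrow> nat \<Rightarrow> (nat \<Rightarrow> 'a) \<Rightarrow> 'a pair_pre_digraph \<Rightarrow> int" where
  "M n k v T = (\<Sum>\<sigma> | \<sigma> permutes {1..n}. sign \<sigma> * int (phi n v T \<sigma> k))"

end

theory Submission
  imports Defs "Jordan_Normal_Form.Determinant"
begin

text \<open>
  With \<open>[m] = 1 + q + \<dots> + q ^ (m - 1)\<close>, the generating function \<open>\<Sum>k. M n k v T * q ^ k\<close> is the
  determinant of the matrix \<open>D n\<close> with entries \<open>[d(v i, v j)]\<close>. Build the tree up by attaching one
  vertex \<open>x\<close> after the other to an earlier vertex \<open>p\<close>; then \<open>d(x, y) = d(p, y) + 1\<close> for all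
  earlier \<open>y\<close>. As \<open>[m + 1] = 1 + q [m]\<close>, subtracting \<open>q\<close> times the row (column) of \<open>p\<close> from that of
  \<open>x\<close> turns the latter into ones, with \<open>- 2 q\<close> on the diagonal. Hence \<open>D (n + 1)\<close> has the same
  determinant as \<open>D n\<close> bordered by ones with corner \<open>- 2 q\<close>. The same operations on bordered
  matrices give a linear recurrence, whose solution is
  \<open>det (D n) = (- 1) ^ (n - 1) * (n - 1) * (1 + q) ^ (n - 2)\<close> for every tree.
\<close>

section \<open>The determinant of a q-distance matrix\<close>

definition geom :: "'a::comm_ring_1 \<Rightarrow> nat \<Rightarrow> 'a" where
  "geom q m = (\<Sum>l<m. q ^ l)"

lemma geom_0 [simp]: "geom q 0 = 0"
  by (simp add: geom_def)

lemma geom_Suc [simp]: "geom q (Suc m) = 1 + q * geom q m"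
  by (simp add: geom_def sum.lessThan_Suc_shift sum_distrib_left del: sum.lessThan_Suc)

definition qdist_mat :: "'a::comm_ring_1 \<Rightarrow> (nat \<Rightarrow> nat \<Rightarrow> nat) \<Rightarrow> nat \<Rightarrow> 'a mat" where
  "qdist_mat q d n = mat n n (\<lambda>(i, j). geom q (d i j))"

definition bordered_mat :: "'a::comm_ring_1 \<Rightarrow> (nat \<Rightarrow> nat \<Rightarrow> nat) \<Rightarrow> nat \<Rightarrow> 'a \<Rightarrow> 'a mat" where
  "bordered_mat q d n c = mat (Suc n) (Suc n)
     (\<lambda>(i, j). if i < n \<and> j < n then geom q (d i j) else if i < n \<or> j < n then 1 else c)"

text \<open>Vertex \<open>n\<close> hangs off the earlier vertex \<open>p\<close>, expressed through
  distances alone. Both directions are recorded because \<open>d\<close> is an arbitrary function,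
  not assumed symmetric.\<close>

definition attached :: "(nat \<Rightarrow> nat \<Rightarrow> nat) \<Rightarrow> nat \<Rightarrow> nat \<Rightarrow> bool" where
  "attached d n p \<longleftrightarrow> p < n \<and> d n n = 0 \<and> d p p = 0 \<and>
     (\<forall>j<n. d n j = Suc (d p j) \<and> d j n = Suc (d j p))"

lemma det_addrow_addcol:
  assumes "A \<in> carrier_mat m m" "l < m" "k \<noteq> l"
  shows "det (addcol a k l (addrow a k l A)) = det A"
  using assms by (simp add: det_addrow det_addcol[of l m])

lemma det_qdist_mat_attached:
  assumes "attached d n p"
  shows "det (qdist_mat q d (Suc n)) = det (bordered_mat q d n (- 2 * q))"
proof -
  have p: "p < n" using assms by (simp add: attached_def)
  \<comment> \<open>At the corner, the row operation turns 0 into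
    \<open>- q * geom q 1 = - q\<close>. It also makes the entry at \<open>(n, p)\<close> equal to
    1, so the column operation subtracts another \<open>q\<close>.\<close>
  have "addcol (- q) n p (addrow (- q) n p (qdist_mat q d (Suc n))) = bordered_mat q d n (- 2 * q)"
    using assms
    by (intro eq_matI) (auto simp: qdist_mat_def bordered_mat_def attached_def less_Suc_eq)
  moreover have "det (addcol (- q) n p (addrow (- q) n p (qdist_mat q d (Suc n))))
      = det (qdist_mat q d (Suc n))"
    using p by (intro det_addrow_addcol[where m = "Suc n"]) (auto simp: qdist_mat_def)
  ultimately show ?thesis by simp
qed

text \<open>After row and column \<open>n\<close> are cleared against \<open>p\<close>, they agree
  with the border at all indices below \<open>n\<close>. Subtracting them from the border leaves
  there only \<open>1 + q\<close> at position \<open>n\<close> and the corner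
  \<open>c - 2\<close>.\<close>

lemma det_bordered_mat_attached:
  assumes "attached d n p"
  shows "det (bordered_mat q d (Suc n) c)
    = (c - 2) * det (bordered_mat q d n (- 2 * q)) - (1 + q)\<^sup>2 * det (qdist_mat q d n)"
proof -
  have p: "p < n" using assms by (simp add: attached_def)
  let ?A = "bordered_mat q d (Suc n) c"
  let ?A1 = "addcol (- q) n p (addrow (- q) n p ?A)"
  let ?A2 = "addcol (- 1) (Suc n) n (addrow (- 1) (Suc n) n ?A1)"
  define R where "R = mat (n + 2) (n + 2) (\<lambda>(i, j).
      if i < n \<and> j < n then geom q (d i j)
      else if i = Suc n \<and> j = Suc n then c - 2
      else if i = n \<and> j = n then - 2 * q
      else if i < n \<and> j = n \<or> i = n \<and> j < n then 1
      else if i = n \<or> j = n then 1 + q else 0)"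
  have A: "?A \<in> carrier_mat (n + 2) (n + 2)"
    by (simp add: bordered_mat_def)
  have R: "R \<in> carrier_mat (n + 2) (n + 2)"
    by (simp add: R_def)
  have A1_eq: "?A1 = mat (n + 2) (n + 2) (\<lambda>(i, j).
      if i < n \<and> j < n then geom q (d i j)
      else if i = Suc n \<and> j = Suc n then c
      else if i = n \<and> j = n then - 2 * q
      else if i < n \<or> j < n then 1
      else 1 - q)"
    using assms
    by (intro eq_matI) (auto simp: bordered_mat_def attached_def less_Suc_eq)
  have "?A2 = R"
    unfolding A1_eq
    by (intro eq_matI) (auto simp: R_def less_Suc_eq)
  moreover have "det ?A2 = det ?A1"
    using A by (intro det_addrow_addcol[where m = "n + 2"]) auto
  moreover have "det ?A1 = det ?A"
    using A p by (intro det_addrow_addcol[where m = "n + 2"]) auto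
  ultimately have "det ?A = det R" by simp
  \<comment> \<open>The last column of \<open>R\<close> has nonzero entries at most in rows
    \<open>n\<close> and \<open>Suc n\<close>.\<close>
  also have "\<dots> = (\<Sum>i<n + 2. R $$ (i, Suc n) * cofactor R i (Suc n))"
    using R by (intro laplace_expansion_column) auto
  also have "\<dots> = (1 + q) * cofactor R n (Suc n) + (c - 2) * cofactor R (Suc n) (Suc n)"
    by (simp add: R_def)
  also have "cofactor R (Suc n) (Suc n) = det (bordered_mat q d n (- 2 * q))"
  proof -
    have "mat_delete R (Suc n) (Suc n) = bordered_mat q d n (- 2 * q)"
      by (intro eq_matI) (auto simp: R_def mat_delete_def bordered_mat_def less_Suc_eq)
    then show ?thesis by (simp add: cofactor_def)
  qed
  also have "cofactor R n (Suc n) = - ((1 + q) * det (qdist_mat q d n))"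
  proof -
    \<comment> \<open>The last row of \<open>S\<close> is the border row of \<open>R\<close> without
      its corner: zero except for \<open>1 + q\<close> in column \<open>n\<close>. The minus sign of
      the cofactor comes from the odd index sum \<open>n + Suc n\<close>.\<close>
    define S where "S = mat_delete R n (Suc n)"
    have S: "S \<in> carrier_mat (Suc n) (Suc n)"
      by (simp add: S_def R_def mat_delete_def)
    have "det S = (\<Sum>j<Suc n. S $$ (n, j) * cofactor S n j)"
      using S by (intro laplace_expansion_row) auto
    also have "\<dots> = (1 + q) * cofactor S n n"
      by (simp add: S_def R_def mat_delete_def)
    also have "mat_delete S n n = qdist_mat q d n"
      by (intro eq_matI) (auto simp: S_def R_def mat_delete_def qdist_mat_def)
    then have "cofactor S n n = det (qdist_mat q d n)"
      by (simp add: cofactor_def)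
    finally show ?thesis
      by (simp add: cofactor_def S_def)
  qed
  finally show ?thesis
    by (simp add: power2_eq_square algebra_simps)
qed

text \<open>
  The attachment recurrences combine to \<open>\<alpha> (n + 2) = - 2 (1 + q) \<alpha> (n + 1) - (1 + q)\<^sup>2 \<alpha> n\<close>,
  whose characteristic polynomial has the double root \<open>- (1 + q)\<close>.
\<close>

lemma det_qdist_mat:
  fixes q :: "'a::comm_ring_1"
  assumes "d 0 0 = 0"
    and "\<And>i. 0 < i \<Longrightarrow> i < n \<Longrightarrow> \<exists>p. attached d i p"
    and "n > 0"
  defines "\<alpha> \<equiv> (\<lambda>n. - of_nat (n - 1) * (- (1 + q)) ^ (n - 2))"
  shows "det (qdist_mat q d n) = \<alpha> n"
proof -
  \<comment> \<open>The recurrences couple both kinds of determinant, so they are computed together.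
    The bordered one is affine in \<open>c\<close> with slope
    \<open>det (qdist_mat q d (Suc m))\<close>, and at \<open>c = - 2 * q\<close> it is the next
    q-distance determinant. This gives the formula for all \<open>c\<close>.\<close>
  have "det (qdist_mat q d (Suc m)) = \<alpha> (Suc m) \<and>
      (\<forall>c. det (bordered_mat q d (Suc m) c) = \<alpha> (Suc (Suc m)) + (c + 2 * q) * \<alpha> (Suc m))"
    if "Suc m \<le> n" for m
    using that
  proof (induction m)
    case 0
    have "det (qdist_mat q d (Suc 0)) = 0"
      using assms(1) by (simp add: det_single qdist_mat_def)
    moreover have "det (bordered_mat q d (Suc 0) c) = - 1" for c
    proof -
      have "det (bordered_mat q d (Suc 0) c)
          = (\<Sum>i<2. bordered_mat q d (Suc 0) c $$ (i, 0) * cofactor (bordered_mat q d (Suc 0) c) i 0)"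
        by (intro laplace_expansion_column) (auto simp: bordered_mat_def)
      also have "\<dots> = - det (mat_delete (bordered_mat q d (Suc 0) c) 1 0)"
        using assms(1) by (simp add: bordered_mat_def cofactor_def numeral_2_eq_2)
      also have "\<dots> = - 1"
        by (subst det_single) (auto simp: bordered_mat_def mat_delete_def)
      finally show ?thesis .
    qed
    ultimately show ?case by (simp add: \<alpha>_def)
  next
    case (Suc m)
    then obtain p where att: "attached d (Suc m) p" using assms(2)[of "Suc m"] by auto
    have IH: "det (qdist_mat q d (Suc m)) = \<alpha> (Suc m)"
      "det (bordered_mat q d (Suc m) c) = \<alpha> (Suc (Suc m)) + (c + 2 * q) * \<alpha> (Suc m)" for c
      using Suc by auto
    \<comment> \<open>The case \<open>m = 0\<close> is separate because the exponent
      \<open>Suc m - 2\<close> is truncated there; the factor \<open>of_nat 0\<close> makes the term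
      vanish.\<close>
    have rec: "\<alpha> (Suc (Suc (Suc m))) = - 2 * (1 + q) * \<alpha> (Suc (Suc m)) - (1 + q)\<^sup>2 * \<alpha> (Suc m)"
      by (cases m) (simp_all add: \<alpha>_def algebra_simps power2_eq_square)
    show ?case
      unfolding det_qdist_mat_attached[OF att] det_bordered_mat_attached[OF att] IH rec
      by (simp add: algebra_simps)
  qed
  from this[of "n - 1"] assms(3) show ?thesis by simp
qed

section \<open>Distances in a tree\<close>

declare (in pair_graph) awalk_verts_with_proj_eq [simp del] cas_with_proj_eq [simp del]

text \<open>
  Two different paths from \<open>u\<close> may be assumed to differ in their first arcs. Follow the second one up
  to its first vertex \<open>z\<close> on the first one and return to \<open>u\<close> along the first one: this is a
  cycle, and its length is at least 3 because the two first arcs have different heads.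
\<close>

lemma (in pair_graph) apath_unique:
  assumes no_cycle: "\<not> (\<exists>c. cycle c \<and> 3 \<le> length c)"
    and "apath u p w" and "apath u q w"
  shows "p = q"
  using assms(2,3)
proof (induction p arbitrary: u q)
  case Nil
  then show ?case
    using apath_nonempty_ends by (fastforce simp: apath_Nil_iff)
next
  case (Cons e p')
  have "u \<noteq> w" using Cons.prems(1) apath_nonempty_ends by blast
  then obtain f q' where q: "q = f # q'"
    using Cons.prems(2) by (cases q) (auto simp: apath_Nil_iff)
  obtain x where e: "e = (u, x)" using Cons.prems(1) by (cases e) (auto simp: apath_Cons_iff)
  obtain y where f: "f = (u, y)" using Cons.prems(2) q by (cases f) (auto simp: apath_Cons_iff)
  have P: "(u, x) \<in> parcs G" "apath x p' w" "u \<notin> set (awalk_verts x p')"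
    using Cons.prems(1) e by (auto simp: apath_Cons_iff)
  have Q: "(u, y) \<in> parcs G" "apath y q' w" "u \<notin> set (awalk_verts y q')"
    using Cons.prems(2) q f by (auto simp: apath_Cons_iff)
  \<comment> \<open>Once the first arcs agree, the induction hypothesis identifies the remaining
    paths.\<close>
  have "x = y"
  proof (rule ccontr)
    assume "x \<noteq> y"
    have "w \<in> set (awalk_verts x p')" "w \<in> set (awalk_verts y q')"
      using P(2) Q(2) by (metis apath_def awalkE last_in_set awalk_verts_non_Nil)+
    then obtain ys z zs where split: "awalk_verts y q' = ys @ z # zs"
      and z: "z \<in> set (awalk_verts x p')" and ys: "\<forall>v\<in>set ys. v \<notin> set (awalk_verts x p')"
      using split_list_first_prop[of "awalk_verts y q'" "\<lambda>v. v \<in> set (awalk_verts x p')"] by blast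
    obtain q1 q2 where q1: "q' = q1 @ q2" "awalk_verts y q1 = ys @ [z]" "cas y q1 z"
      using Q(2) split by (metis apath_def awalkE awalk_decomp_verts)
    then have walk_q1: "awalk y q1 z"
      using Q(2) by (auto simp: apath_def awalk_def)
    obtain p1 p2 where p1: "p' = p1 @ p2" "awalk x p1 z" "awalk z p2 w"
      using P(2) z awalk_decomp by (metis apath_def)
    have sub: "set (awalk_verts x p1) \<subseteq> set (awalk_verts x p')"
      using p1 set_awalk_verts_append[OF p1(2,3)] by auto
    have dist_p1: "distinct (awalk_verts x p1)"
      using P(2) p1 apath_append_iff[of x p1 p2 w] by (auto simp: apath_def)
    have dist_q: "distinct (ys @ z # zs)"
      using Q(2) split by (metis apath_def)
    obtain rs where rs: "rev (awalk_verts x p1) = z # rs"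
      using p1(2) by (metis awalkE awalk_verts_non_Nil hd_rev list.collapse rev_is_Nil_conv)
    have rev_p1: "awalk z (rev_path p1) x" "awalk_verts z (rev_path p1) = z # rs"
      using p1(2) awalk_verts_rev_path[OF p1(2)] rs by auto
    have rs_props: "distinct (z # rs)" "set (z # rs) \<subseteq> set (awalk_verts x p')"
      using dist_p1 sub rs by (metis distinct_rev, metis set_rev)
    define c where "c = f # q1 @ rev_path p1 @ [(x, u)]"
    have arc: "(x, u) \<in> parcs G" "u \<in> pverts G"
      using P(1) arcs_symmetric in_arcsD1 by auto
    then have last: "awalk x [(x, u)] u"
      by (simp add: awalk_simps)
    have walk_tail: "awalk y (q1 @ rev_path p1 @ [(x, u)]) u"
      using walk_q1 rev_p1(1) last by (meson awalk_appendI)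
    then have walk: "awalk u c u"
      using walk_tail Q(1) by (simp add: c_def f awalk_Cons_iff del: awalk_append_iff)
    have "awalk_verts u c = u # awalk_verts y (q1 @ rev_path p1 @ [(x, u)])"
      by (simp add: c_def f)
    also have "awalk_verts y (q1 @ rev_path p1 @ [(x, u)]) = ys @ [z] @ rs @ [u]"
    proof -
      have w2: "awalk z (rev_path p1 @ [(x, u)]) u"
        using rev_p1(1) last by (meson awalk_appendI)
      have "awalk_verts z (rev_path p1 @ [(x, u)]) = z # rs @ [u]"
        using awalk_verts_append[OF w2] rev_p1
        by simp
      then show ?thesis
        using awalk_verts_append[OF walk_tail] q1(2)
        by simp
    qed
    \<comment> \<open>By the choice of \<open>z\<close>, \<open>ys\<close> is disjoint from the
      first path, which contains \<open>z # rs\<close>. Neither path returns to \<open>u\<close>, so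
      \<open>u\<close> occurs only at the end.\<close>
    finally have "distinct (tl (awalk_verts u c))"
      using dist_q ys rs_props P(3) Q(3) split by auto
    then have "cycle c"
      using walk unfolding cycle_def c_def by auto
    \<comment> \<open>If both were empty, \<open>z\<close> would equal both \<open>x\<close> and
      \<open>y\<close>.\<close>
    moreover have "q1 \<noteq> [] \<or> p1 \<noteq> []"
      using \<open>x \<noteq> y\<close> walk_q1 p1(2) by (auto simp: awalk_Nil_iff)
    then have "3 \<le> length c"
      by (cases q1; cases p1) (auto simp: c_def)
    ultimately show False using no_cycle by blast
  qed
  then show ?case
    using Cons.IH P Q q e f by blast
qed

section \<open>Distances in a tree grown one vertex at a time\<close>

locale simple_tree_graph = pair_graph G for G :: "'a pair_pre_digraph" +
  assumes connected: "Digraph_Component.connected (with_proj G)"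
    and no_long_cycle: "\<not> (\<exists>c. cycle c \<and> 3 \<le> length c)"
begin

text \<open>By uniqueness of paths, the definite description in \<open>tree_dist\<close> denotes
  whichever path is at hand.\<close>

lemma tree_dist_apath:
  assumes "apath u p w"
  shows "tree_dist G u w = length p"
proof -
  have "(THE p. apath u p w) = p"
    using assms apath_unique[OF no_long_cycle] by blast
  then show ?thesis by (simp add: tree_dist_def)
qed

lemma tree_dist_self:
  "u \<in> pverts G \<Longrightarrow> tree_dist G u u = 0"
  using tree_dist_apath[of u "[]" u] by (simp add: apath_Nil_iff)

lemma apath_exists:
  assumes "u \<in> pverts G" "w \<in> pverts G"
  shows "\<exists>p. apath u p w"
proof -
  have "strongly_connected (with_proj G)"
    using symmetric_connected_imp_strongly_connected connected graph_symmetric by blast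
  then show ?thesis
    using assms by (auto simp: strongly_connected_def reachable_apath)
qed

text \<open>Connectedness is stated through paths of the whole tree that stay in \<open>S\<close>.
  Hence distances within \<open>S\<close> are those of the tree, and such paths avoid every vertex
  outside \<open>S\<close>.\<close>

definition subtree :: "'a set \<Rightarrow> bool" where
  "subtree S \<longleftrightarrow> S \<subseteq> pverts G \<and>
     (\<forall>u\<in>S. \<forall>w\<in>S. \<exists>p. apath u p w \<and> set (awalk_verts u p) \<subseteq> S)"

lemma subtree_apath:
  assumes "subtree S" "u \<in> S" "w \<in> S"
  obtains p where "apath u p w" "set (awalk_verts u p) \<subseteq> S"
  using assms unfolding subtree_def by metis

text \<open>A path from \<open>p\<close> to \<open>y\<close> inside \<open>S\<close> misses
  \<open>x\<close>, so prefixing the arc \<open>(x, p)\<close> yields a path from \<open>x\<close>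
  to \<open>y\<close> that is one arc longer. Its reversal handles the other direction.\<close>

lemma subtree_attach:
  assumes S: "subtree S" and "p \<in> S" and "x \<notin> S" and arc: "(x, p) \<in> parcs G"
  shows "subtree (insert x S)"
    and "\<And>y. y \<in> S \<Longrightarrow> tree_dist G x y = Suc (tree_dist G p y)"
    and "\<And>y. y \<in> S \<Longrightarrow> tree_dist G y x = Suc (tree_dist G y p)"
proof -
  have x: "x \<in> pverts G" using arc in_arcsD1 by blast
  have from_x: "\<exists>r. apath x r y \<and> length r = Suc (tree_dist G p y) \<and>
      set (awalk_verts x r) \<subseteq> insert x S \<and>
      apath y (rev_path r) x \<and> length (rev_path r) = Suc (tree_dist G y p) \<and>
      set (awalk_verts y (rev_path r)) \<subseteq> insert x S"
    if "y \<in> S" for y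
  proof -
    obtain r where r: "apath p r y" "set (awalk_verts p r) \<subseteq> S"
      using subtree_apath[OF S \<open>p \<in> S\<close> \<open>y \<in> S\<close>] by blast
    have path: "apath x ((x, p) # r) y"
      using r arc \<open>x \<notin> S\<close> by (auto simp: apath_Cons_iff)
    have verts: "set (awalk_verts x ((x, p) # r)) \<subseteq> insert x S"
      using r by auto
    have "awalk_verts y (rev_path ((x, p) # r)) = rev (awalk_verts x ((x, p) # r))"
      using path by (intro awalk_verts_rev_path) (simp add: apath_def)
    then have verts': "set (awalk_verts y (rev_path ((x, p) # r))) \<subseteq> insert x S"
      using verts by simp
    have path': "apath y (rev_path ((x, p) # r)) x"
      using path by (simp only: apath_rev_path)
    have "tree_dist G p y = length r" using r(1) by (rule tree_dist_apath)
    moreover have "tree_dist G y p = length (rev_path r)"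
      using r(1) by (intro tree_dist_apath) simp
    ultimately show ?thesis
      using path path' verts verts' by (intro exI[of _ "(x, p) # r"]) simp
  qed
  show "tree_dist G x y = Suc (tree_dist G p y)" if "y \<in> S" for y
    using from_x[OF that] tree_dist_apath by metis
  show "tree_dist G y x = Suc (tree_dist G y p)" if "y \<in> S" for y
    using from_x[OF that] tree_dist_apath by metis
  have "apath x [] x" "set (awalk_verts x []) \<subseteq> insert x S"
    using x by (auto simp: apath_Nil_iff)
  moreover have "\<exists>r. apath u r w \<and> set (awalk_verts u r) \<subseteq> insert x S" if "u \<in> S" "w \<in> S" for u w
    using subtree_apath[OF S that] by (metis subset_insertI2)
  moreover have "\<exists>r. apath x r y \<and> set (awalk_verts x r) \<subseteq> insert x S"
    "\<exists>r. apath y r x \<and> set (awalk_verts y r) \<subseteq> insert x S" if "y \<in> S" for y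
    using from_x[OF that] by metis+
  moreover have "insert x S \<subseteq> pverts G"
    using S x by (simp add: subtree_def)
  ultimately show "subtree (insert x S)"
    unfolding subtree_def by (metis insert_iff)
qed

text \<open>Some arc of a walk from \<open>s\<close> to a vertex outside \<open>S\<close> leaves
  \<open>S\<close>. It is returned reversed, from the new vertex to the old one, as
  \<open>subtree_attach\<close> expects.\<close>

lemma arc_leaving:
  assumes "S \<subseteq> pverts G" "s \<in> S" "S \<noteq> pverts G"
  shows "\<exists>x p. p \<in> S \<and> x \<notin> S \<and> (x, p) \<in> parcs G"
proof -
  obtain t where t: "t \<in> pverts G" "t \<notin> S" using assms by blast
  obtain r where "apath s r t" using apath_exists assms t by blast
  then have "awalk s r t" by (simp add: apath_def)
  then show ?thesis
    using \<open>s \<in> S\<close> t(2)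
  proof (induction r arbitrary: s)
    case Nil
    then show ?case by (simp add: awalk_Nil_iff)
  next
    case (Cons e r)
    then have e: "e \<in> parcs G" "s = fst e" "awalk (snd e) r t"
      by (auto simp: awalk_Cons_iff)
    show ?case
    proof (cases "snd e \<in> S")
      case True
      then show ?thesis using Cons e by blast
    next
      case False
      have "(snd e, fst e) \<in> parcs G" using e(1) arcs_symmetric by (cases e) auto
      then show ?thesis using False e Cons.prems by blast
    qed
  qed
qed

text \<open>As long as \<open>w\<close> does not exhaust the vertices, an arc joins a new vertex to
  its image, and that vertex comes next. Being a \<open>subtree\<close> is the invariant that lets
  \<open>subtree_attach\<close> supply the distances.\<close>

lemma growing_enumeration:
  assumes "0 < m" "m \<le> card (pverts G)"
  shows "\<exists>w. inj_on w {..<m} \<and> subtree (w ` {..<m}) \<and>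
    (\<forall>i. 0 < i \<and> i < m \<longrightarrow> (\<exists>p<i. \<forall>j<i.
      tree_dist G (w i) (w j) = Suc (tree_dist G (w p) (w j)) \<and>
      tree_dist G (w j) (w i) = Suc (tree_dist G (w j) (w p))))"
  using assms
proof (induction m rule: nat_induct_non_zero)
  case 1
  then obtain r where "r \<in> pverts G" by fastforce
  then have "subtree {r}"
    by (auto simp: subtree_def apath_Nil_iff intro: exI[of _ "[]"])
  then show ?case by (intro exI[of _ "\<lambda>_. r"]) (auto simp: lessThan_Suc)
next
  case (Suc m)
  then obtain w where inj: "inj_on w {..<m}" and sub: "subtree (w ` {..<m})"
    and dist: "\<And>i. 0 < i \<Longrightarrow> i < m \<Longrightarrow> \<exists>p<i. \<forall>j<i.
      tree_dist G (w i) (w j) = Suc (tree_dist G (w p) (w j)) \<and>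
      tree_dist G (w j) (w i) = Suc (tree_dist G (w j) (w p))"
    by (metis Suc_leD)
  have "card (w ` {..<m}) \<noteq> card (pverts G)"
    using Suc.prems by (simp add: card_image[OF inj])
  moreover have "w ` {..<m} \<subseteq> pverts G" using sub by (simp add: subtree_def)
  moreover have "w 0 \<in> w ` {..<m}" using \<open>0 < m\<close> by simp
  ultimately obtain x y where y: "y \<in> w ` {..<m}" and x: "x \<notin> w ` {..<m}"
    and arc: "(x, y) \<in> parcs G"
    using arc_leaving[of "w ` {..<m}" "w 0"] by metis
  note attach = subtree_attach[OF sub y x arc]
  obtain p where p: "p < m" "y = w p" using y by auto
  let ?w = "w(m := x)"
  have img: "?w ` {..<Suc m} = insert x (w ` {..<m})"
    by (auto simp: lessThan_Suc)
  have "inj_on ?w {..<Suc m}"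
    using inj x by (auto simp: lessThan_Suc inj_on_def)
  moreover have "subtree (?w ` {..<Suc m})"
    using attach(1) img by simp
  moreover have "\<exists>p<i. \<forall>j<i.
      tree_dist G (?w i) (?w j) = Suc (tree_dist G (?w p) (?w j)) \<and>
      tree_dist G (?w j) (?w i) = Suc (tree_dist G (?w j) (?w p))"
    if "0 < i" "i < Suc m" for i
  proof (cases "i = m")
    case True
    then show ?thesis using attach(2,3) p by (intro exI[of _ p]) simp
  next
    case False
    then have "i < m" using that by simp
    with dist[OF \<open>0 < i\<close>] show ?thesis
      by (fastforce)
  qed
  ultimately show ?case by blast
qed

end

lemma simple_tree_graphI: "simple_tree T \<Longrightarrow> simple_tree_graph T"
  by (simp add: simple_tree_def simple_tree_graph_def simple_tree_graph_axioms_def)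

section \<open>The generating function\<close>

text \<open>Expanding the product chooses an exponent \<open>x i < b i\<close> from each factor, and
  the coefficient counts the choices with sum \<open>k\<close>. Here \<open>monom 1 1\<close> is the
  indeterminate \<open>q\<close>.\<close>

lemma coeff_prod_geom:
  fixes b :: "nat \<Rightarrow> nat"
  assumes "finite I"
  shows "coeff (\<Prod>i\<in>I. geom (monom 1 1 :: int poly) (b i)) k
    = int (card {x \<in> I \<rightarrow>\<^sub>E (UNIV :: int set). (\<Sum>i\<in>I. x i) = int k \<and> (\<forall>i\<in>I. 0 \<le> x i \<and> x i < int (b i))})"
proof -
  let ?P = "Pi\<^sub>E I (\<lambda>i. {0..<int (b i)})"
  have fin: "finite ?P" using assms by (intro finite_PiE) auto
  have geom: "geom (monom 1 1 :: int poly) m = (\<Sum>y\<in>{0..<int m}. monom 1 (nat y))" for m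
  proof -
    have "(\<Sum>y\<in>{0..<int m}. monom (1::int) (nat y)) = (\<Sum>l<m. monom 1 l)"
      by (rule sum.reindex_bij_witness[of _ int nat]) auto
    then show ?thesis by (simp add: geom_def monom_power)
  qed
  have "(\<Prod>i\<in>I. geom (monom 1 1 :: int poly) (b i)) = (\<Sum>x\<in>?P. \<Prod>i\<in>I. monom 1 (nat (x i)))"
    unfolding geom using assms by (simp add: prod_sum_PiE)
  also have "\<dots> = (\<Sum>x\<in>?P. monom 1 (nat (\<Sum>i\<in>I. x i)))"
  proof (rule sum.cong[OF refl])
    fix x assume x: "x \<in> ?P"
    have "(\<Prod>i\<in>I. monom (1::int) (nat (x i))) = monom 1 (\<Sum>i\<in>I. nat (x i))"
      using assms by (induction I rule: finite_induct) (auto simp: mult_monom)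
    also have "(\<Sum>i\<in>I. nat (x i)) = nat (\<Sum>i\<in>I. x i)"
    proof -
      have "int (\<Sum>i\<in>I. nat (x i)) = (\<Sum>i\<in>I. x i)"
        using x unfolding of_nat_sum by (intro sum.cong) (auto simp: PiE_iff)
      then show ?thesis by (metis nat_int)
    qed
    finally show "(\<Prod>i\<in>I. monom (1::int) (nat (x i))) = monom 1 (nat (\<Sum>i\<in>I. x i))" .
  qed
  finally have "coeff (\<Prod>i\<in>I. geom (monom 1 1 :: int poly) (b i)) k
      = (\<Sum>x\<in>?P. if nat (\<Sum>i\<in>I. x i) = k then 1 else 0)"
    by (simp add: coeff_sum)
  also have "\<dots> = int (card {x \<in> ?P. nat (\<Sum>i\<in>I. x i) = k})"
    using fin by (simp flip: sum.inter_filter)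
  also have "{x \<in> ?P. nat (\<Sum>i\<in>I. x i) = k} = {x \<in> I \<rightarrow>\<^sub>E (UNIV :: int set).
      (\<Sum>i\<in>I. x i) = int k \<and> (\<forall>i\<in>I. 0 \<le> x i \<and> x i < int (b i))}"
  proof -
    \<comment> \<open>Nonnegativity matters for \<open>k = 0\<close>, since \<open>nat\<close> sends
      negative integers to 0 as well.\<close>
    have "nat (\<Sum>i\<in>I. x i) = k \<longleftrightarrow> (\<Sum>i\<in>I. x i) = int k" if "\<forall>i\<in>I. 0 \<le> x i" for x :: "nat \<Rightarrow> int"
      using sum_nonneg[of I x] that by auto
    then show ?thesis by (auto simp: PiE_iff)
  qed
  finally show ?thesis .
qed

text \<open>This is the Leibniz formula, combined with the invariance of determinants under
  renumbering rows and columns simultaneously. It permits replacing the given enumeration of the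
  vertices by a growing one.\<close>

lemma sum_sign_permutes_reindex:
  fixes f :: "nat \<Rightarrow> nat \<Rightarrow> 'a::comm_ring_1"
  assumes e: "bij_betw e {0..<n} {1..n}"
  shows "(\<Sum>\<sigma> | \<sigma> permutes {1..n}. of_int (sign \<sigma>) * (\<Prod>i\<in>{1..n}. f i (\<sigma> i)))
    = det (mat n n (\<lambda>(i, j). f (e i) (e j)))"
proof -
  \<comment> \<open>\<open>e\<close> extended to a permutation of \<open>{0..n}\<close>, so that both sums are over permutations of
    subsets of one set and conjugation by \<open>\<pi>\<close> visibly preserves signs\<close>
  define \<pi> where "\<pi> = (\<lambda>i. if i < n then e i else if i = n then 0 else i)"
  have img: "\<pi> ` {0..<n} = {1..n}" and inj: "inj_on \<pi> {0..<n}"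
    using e by (auto simp: \<pi>_def bij_betw_def inj_on_def)
  have img_insert: "{0..n} = insert n {0..<n}" by auto
  have "\<pi> ` {0..n} = {0..n}"
  proof -
    have "\<pi> ` {0..n} = insert (\<pi> n) (\<pi> ` {0..<n})"
      unfolding img_insert by simp
    also have "\<dots> = {0..n}"
      unfolding img by (auto simp: \<pi>_def)
    finally show ?thesis .
  qed
  then have perm: "\<pi> permutes {0..n}"
    by (intro bij_imp_permutes) (auto simp: \<pi>_def bij_betw_def eq_card_imp_inj_on)
  then have bij: "bij \<pi>" by (rule permutes_bij)
  have conj: "\<pi> \<circ> \<tau> \<circ> inv_into UNIV \<pi> permutes {1..n}" if "\<tau> permutes {0..<n}" for \<tau>
  proof -
    \<comment> \<open>A point outside \<open>{1..n}\<close> is pulled back outside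
      \<open>{0..<n}\<close>, where \<open>\<tau>\<close> is the identity.\<close>
    have "\<pi> (\<tau> (inv_into UNIV \<pi> x)) = x" if "x \<notin> {1..n}" for x
    proof -
      have "inv_into UNIV \<pi> x \<notin> {0..<n}"
        using that img bij by (metis bij_inv_eq_iff imageI)
      then show ?thesis
        using \<open>\<tau> permutes {0..<n}\<close> bij by (simp add: permutes_not_in bij_is_surj surj_f_inv_f)
    qed
    moreover have "bij (\<pi> \<circ> \<tau> \<circ> inv_into UNIV \<pi>)"
      using bij permutes_bij[OF that] by (intro bij_comp bij_imp_bij_inv)
    ultimately show ?thesis
      unfolding permutes_def bij_iff comp_apply by blast
  qed
  have conj': "inv_into UNIV \<pi> \<circ> \<sigma> \<circ> \<pi> permutes {0..<n}" if "\<sigma> permutes {1..n}" for \<sigma>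
  proof -
    have "inv_into UNIV \<pi> (\<sigma> (\<pi> x)) = x" if "x \<notin> {0..<n}" for x
    proof -
      have "\<pi> x \<notin> {1..n}"
        using that img bij by (metis bij_is_inj image_iff inj_eq)
      then show ?thesis
        using \<open>\<sigma> permutes {1..n}\<close> bij by (simp add: permutes_not_in bij_is_inj)
    qed
    moreover have "bij (inv_into UNIV \<pi> \<circ> \<sigma> \<circ> \<pi>)"
      using bij permutes_bij[OF that] by (intro bij_comp bij_imp_bij_inv)
    ultimately show ?thesis
      unfolding permutes_def bij_iff comp_apply by blast
  qed
  have "(\<Sum>\<sigma> | \<sigma> permutes {1..n}. of_int (sign \<sigma>) * (\<Prod>i\<in>{1..n}. f i (\<sigma> i)))
      = (\<Sum>\<tau> | \<tau> permutes {0..<n}. of_int (sign \<tau>) * (\<Prod>i\<in>{0..<n}. f (\<pi> i) (\<pi> (\<tau> i))))"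
  proof (rule sum.reindex_bij_witness[of _ "\<lambda>\<tau>. \<pi> \<circ> \<tau> \<circ> inv_into UNIV \<pi>" "\<lambda>\<sigma>. inv_into UNIV \<pi> \<circ> \<sigma> \<circ> \<pi>"])
    fix \<sigma> assume "\<sigma> \<in> {\<sigma>. \<sigma> permutes {1..n}}"
    then have \<sigma>: "\<sigma> permutes {1..n}" by simp
    show "\<pi> \<circ> (inv_into UNIV \<pi> \<circ> \<sigma> \<circ> \<pi>) \<circ> inv_into UNIV \<pi> = \<sigma>"
      using bij by (simp add: fun_eq_iff bij_is_surj surj_f_inv_f)
    show "inv_into UNIV \<pi> \<circ> \<sigma> \<circ> \<pi> \<in> {\<tau>. \<tau> permutes {0..<n}}"
      using conj'[OF \<sigma>] by simp
    have "permutation \<pi>" "permutation \<sigma>"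
      using perm \<sigma> by (auto intro: permutes_imp_permutation[rotated])
    \<comment> \<open>A permutation and its inverse have the same sign, so \<open>\<pi>\<close>
      contributes the square of its sign, which is 1.\<close>
    then have "sign (inv_into UNIV \<pi> \<circ> \<sigma> \<circ> \<pi>) = sign \<sigma>"
      by (simp add: sign_compose permutation_compose permutation_inverse sign_inverse sign_idempotent
          mult.commute[of "sign \<pi>"] mult.assoc)
    moreover have "(\<Prod>i\<in>{0..<n}. f (\<pi> i) (\<pi> ((inv_into UNIV \<pi> \<circ> \<sigma> \<circ> \<pi>) i))) = (\<Prod>i\<in>{1..n}. f i (\<sigma> i))"
      using bij unfolding img[symmetric]
      by (simp add: prod.reindex[OF inj] bij_is_surj surj_f_inv_f)
    ultimately show "of_int (sign (inv_into UNIV \<pi> \<circ> \<sigma> \<circ> \<pi>)) *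
        (\<Prod>i\<in>{0..<n}. f (\<pi> i) (\<pi> ((inv_into UNIV \<pi> \<circ> \<sigma> \<circ> \<pi>) i))) = of_int (sign \<sigma>) * (\<Prod>i\<in>{1..n}. f i (\<sigma> i))"
      by simp
  next
    fix \<tau> assume "\<tau> \<in> {\<tau>. \<tau> permutes {0..<n}}"
    then show "\<pi> \<circ> \<tau> \<circ> inv_into UNIV \<pi> \<in> {\<sigma>. \<sigma> permutes {1..n}}" using conj by simp
    show "inv_into UNIV \<pi> \<circ> (\<pi> \<circ> \<tau> \<circ> inv_into UNIV \<pi>) \<circ> \<pi> = \<tau>"
      using bij by (simp add: fun_eq_iff bij_is_inj)
  qed
  also have "\<dots> = det (mat n n (\<lambda>(i, j). f (e i) (e j)))"
    unfolding det_def'[OF mat_carrier]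
  proof (intro sum.cong refl arg_cong2[of _ _ _ _ "(*)"] prod.cong)
    fix \<tau> i assume "\<tau> \<in> {\<tau>. \<tau> permutes {0..<n}}" and i: "i \<in> {0..<n}"
    then have "\<tau> i \<in> {0..<n}" by (simp add: permutes_in_image)
    then show "f (\<pi> i) (\<pi> (\<tau> i)) = mat n n (\<lambda>(i, j). f (e i) (e j)) $$ (i, \<tau> i)"
      using i by (simp add: \<pi>_def)
  qed
  finally show ?thesis .
qed

section \<open>From the determinant to its coefficients\<close>

lemma M_simple_tree:
  assumes tree: "simple_tree T" and n: "n \<ge> 2" and v: "bij_betw v {1..n} (pverts T)"
  shows "M n k v T = (- 1) ^ (n - 1) * int (n - 1) * int ((n - 2) choose k)"
proof -
  interpret simple_tree_graph T using tree by (rule simple_tree_graphI)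
  let ?q = "monom 1 1 :: int poly"
  let ?b = "\<lambda>i j. tree_dist T (v i) (v j)"
  have card: "card (pverts T) = n" using bij_betw_same_card[OF v] by simp
  \<comment> \<open>A fixed point gives a factor \<open>geom ?q 0 = 0\<close>, which agrees with the
    value 0 prescribed by \<open>phi\<close>.\<close>
  have phi: "int (phi n v T \<sigma> k) = coeff (\<Prod>i\<in>{1..n}. geom ?q (?b i (\<sigma> i))) k" for \<sigma>
  proof (cases "\<exists>i\<in>{1..n}. \<sigma> i = i")
    case True
    then obtain i where "i \<in> {1..n}" "\<sigma> i = i" by blast
    moreover from this v have "?b i (\<sigma> i) = 0"
      by (auto intro!: tree_dist_self dest: bij_betwE)
    ultimately have "(\<Prod>i\<in>{1..n}. geom ?q (?b i (\<sigma> i))) = 0"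
      by (intro prod_zero) (auto intro!: bexI[of _ i])
    then have "coeff (\<Prod>i\<in>{1..n}. geom ?q (?b i (\<sigma> i))) k = 0" by (simp only: coeff_0)
    then show ?thesis using True by (simp only: phi_def if_True of_nat_0)
  next
    case False
    then show ?thesis
      by (simp only: phi_def if_False coeff_prod_geom finite_atLeastAtMost)
  qed
  obtain w where inj: "inj_on w {..<n}" and sub: "subtree (w ` {..<n})"
    and dist: "\<And>i. 0 < i \<Longrightarrow> i < n \<Longrightarrow> \<exists>p<i. \<forall>j<i.
      tree_dist T (w i) (w j) = Suc (tree_dist T (w p) (w j)) \<and>
      tree_dist T (w j) (w i) = Suc (tree_dist T (w j) (w p))"
    using growing_enumeration[of n] n card by auto
  have w: "w ` {0..<n} = pverts T"
    using sub card card_image[OF inj] pair_finite_verts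
    by (intro card_subset_eq) (auto simp: subtree_def lessThan_atLeast0)
  then have w_bij: "bij_betw w {0..<n} (pverts T)"
    using inj by (simp add: bij_betw_def lessThan_atLeast0)
  \<comment> \<open>\<open>e\<close> sends a position in the growing enumeration \<open>w\<close> to
    the index of the same vertex in \<open>v\<close>.\<close>
  define e where "e = inv_into {1..n} v \<circ> w"
  have e: "bij_betw e {0..<n} {1..n}"
    unfolding e_def using w_bij bij_betw_inv_into[OF v] by (rule bij_betw_trans)
  have ve: "v (e i) = w i" if "i < n" for i
  proof -
    have "w i \<in> v ` {1..n}" using w that v by (auto simp: bij_betw_def)
    then show ?thesis by (simp add: e_def f_inv_into_f)
  qed
  let ?d = "\<lambda>i j. tree_dist T (w i) (w j)"
  have self: "?d i i = 0" if "i < n" for i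
    using that w by (intro tree_dist_self) auto
  have "M n k v T = coeff (\<Sum>\<sigma> | \<sigma> permutes {1..n}.
      of_int (sign \<sigma>) * (\<Prod>i\<in>{1..n}. geom ?q (?b i (\<sigma> i)))) k"
    by (simp add: M_def phi coeff_sum of_int_poly)
  also have "\<dots> = coeff (det (mat n n (\<lambda>(i, j). geom ?q (?b (e i) (e j))))) k"
    by (subst sum_sign_permutes_reindex[OF e]) simp
  also have "mat n n (\<lambda>(i, j). geom ?q (?b (e i) (e j))) = qdist_mat ?q ?d n"
    by (intro eq_matI) (auto simp: qdist_mat_def ve)
  also have "det \<dots> = - of_nat (n - 1) * (- (1 + ?q)) ^ (n - 2)"
  proof (rule det_qdist_mat)
    fix i assume i: "0 < i" "i < n"
    show "\<exists>p. attached ?d i p"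
    proof -
      obtain p where "p < i" "\<forall>j<i. ?d i j = Suc (?d p j) \<and> ?d j i = Suc (?d j p)"
        using dist[OF i] by blast
      then show ?thesis using i self by (intro exI[of _ p]) (simp add: attached_def)
    qed
  qed (use self n in auto)
  \<comment> \<open>With \<open>n = m + 2\<close>, the leading minus sign and
    \<open>(- 1) ^ m\<close> combine to \<open>(- 1) ^ (n - 1)\<close>.\<close>
  also have "\<dots> = smult ((- 1) ^ (n - 1) * int (n - 1)) ([:1, 1:] ^ (n - 2))"
  proof -
    have q: "1 + ?q = [:1, 1:]" by (simp add: monom_altdef one_pCons)
    obtain m where m: "n = m + 2" using n by (metis add.commute le_Suc_ex)
    have smult: "smult c r = of_int c * r" for c and r :: "int poly"
      by (simp add: of_int_poly)
    have minus: "(- [:1, 1:]) ^ m = (- 1) ^ m * ([:1, 1:] :: int poly) ^ m"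
      by (rule power_minus)
    show ?thesis
      unfolding smult q m by (simp only: minus diff_add_inverse2) (simp add: algebra_simps)
  qed
  also have "coeff \<dots> k = (- 1) ^ (n - 1) * int (n - 1) * int ((n - 2) choose k)"
  proof (cases "k \<le> n - 2")
    case True
    then show ?thesis by (simp add: coeff_linear_poly_power)
  next
    case False
    \<comment> \<open>The power has degree \<open>n - 2\<close>, so beyond it the coefficient
      vanishes together with the binomial coefficient.\<close>
    then have "coeff ([:1, 1:: int:] ^ (n - 2)) k = 0"
      by (intro coeff_eq_0) (simp add: degree_linear_power)
    then show ?thesis using False by simp
  qed
  finally show ?thesis .
qed

text \<open>Independence of the structure is expressed by comparing \<open>T\<close> with any other
  tree on \<open>n\<close> vertices, possibly over another vertex type \<open>'b\<close>; both
  values equal the same closed form.\<close>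

theorem theorem3p6:
  fixes T :: "'a pair_pre_digraph" and v :: "nat \<Rightarrow> 'a" and n k :: nat
  assumes "simple_tree T"
    and "n \<ge> 2"
    and "bij_betw v {1..n} (pverts T)"
  shows "M n k v T = (- 1) ^ (n - 1) * int (n - 1) * int ((n - 2) choose k)
    \<and> (\<forall>(T' :: 'b pair_pre_digraph) (v' :: nat \<Rightarrow> 'b).
          simple_tree T' \<and> bij_betw v' {1..n} (pverts T') \<longrightarrow> M n k v' T' = M n k v T)"
  using assms by (simp add: M_simple_tree)

end
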